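(* Let $H$ be a separable Hilbert space with a fixed orthonormal basis $\{e_n\}_{n\in\mathbb N}$. Let $$\mathbb I(H)=\Bigl\{a\in\mathbb B_f(H):\lim_{n\to\infty}\sup_{i,j\geq n}|a_{ij}|=0\Bigr\},$$ where $(a_{ij})_{i,j\in\mathbb N}$ is the matrix of $a$ with respect to the fixed basis. Then $\mathbb I(H)$ is the maximal closed two-sided proper ideal in $\mathbb B_f(H)$; that is, $\mathbb I(H)$ is a proper closed two-sided ideal of $\mathbb B_f(H)$, and every proper closed two-sided ideal of $\mathbb B_f(H)$ is contained in $\mathbb I(H)$.
   Context: For a Hilbert space $H$ with fixed orthonormal basis $\{e_n\}_{n\in\mathbb N}$, $\mathbb B(H)$ denotes the bounded operators, and operators are identified with their matrices with respect to this basis. For $k\in\mathbb N$, $\mathbb B^{(k)}(H)$ is the set of all $a\in\mathbb B(H)$ whose matrix has no more than $k$ non-zero entries in each line (row) and no more than $k$ non-zero entries in each column. $\mathbb B^{(\infty)}(H)=\bigcup_{k\in\mathbb N}\mathbb B^{(k)}(H)$, and $\mathbb B_f(H)$ is the operator-norm closure of $\mathbb B^{(\infty)}(H)$ in $\mathbb B(H)$; it is a unital $C^*$-subalgebra of $\mathbb B(H)$. *)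

theory Defs
  imports "HOL-Analysis.Analysis"
begin

text \<open>
  Complex Hilbert spaces. The inner product is linear in the first argument. Positive
  definiteness is contained in \<open>cinner_self\<close>, as the norm is already a norm, and
  completeness comes from \<^class>\<open>banach\<close>.
\<close>

class chilbert_space = banach +
  fixes scaleC :: "complex \<Rightarrow> 'a \<Rightarrow> 'a"  (infixr "*\<^sub>C" 75)
    and cinner :: "'a \<Rightarrow> 'a \<Rightarrow> complex"
  assumes scaleC_add_right: "c *\<^sub>C (x + y) = c *\<^sub>C x + c *\<^sub>C y"
    and scaleC_add_left: "(c + d) *\<^sub>C x = c *\<^sub>C x + d *\<^sub>C x"
    and scaleC_scaleC: "c *\<^sub>C (d *\<^sub>C x) = (c * d) *\<^sub>C x"
    and scaleR_scaleC: "scaleR r x = complex_of_real r *\<^sub>C x"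
    and cinner_commute: "cinner x y = cnj (cinner y x)"
    and cinner_add_left: "cinner (x + y) z = cinner x z + cinner y z"
    and cinner_scaleC_left: "cinner (c *\<^sub>C x) y = c * cinner x y"
    and cinner_self: "cinner x x = complex_of_real ((norm x)\<^sup>2)"

lemma scaleC_one: "1 *\<^sub>C x = (x :: 'a::chilbert_space)"
  using scaleR_scaleC[of 1 x] by simp

global_interpretation complex_vector:
  vector_space "scaleC :: complex \<Rightarrow> 'a \<Rightarrow> 'a::chilbert_space"
  by unfold_locales (simp_all add: scaleC_add_right scaleC_add_left scaleC_scaleC scaleC_one)

lemma norm_scaleC: "norm (c *\<^sub>C x) = cmod c * norm (x :: 'a::chilbert_space)"
proof -
  have "cinner (c *\<^sub>C x) (c *\<^sub>C x) = c * (cnj c * cinner x x)"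
    by (metis cinner_commute cinner_scaleC_left complex_cnj_mult)
  then have "complex_of_real ((norm (c *\<^sub>C x))\<^sup>2) = complex_of_real ((cmod c * norm x)\<^sup>2)"
    by (simp add: cinner_self power_mult_distrib complex_norm_square mult.assoc
        flip: of_real_power)
  then have "(norm (c *\<^sub>C x))\<^sup>2 = (cmod c * norm x)\<^sup>2"
    using of_real_eq_iff by blast
  then show ?thesis
    by simp
qed

lemma bounded_linear_scaleC: "bounded_linear ((*\<^sub>C) c :: 'a \<Rightarrow> 'a::chilbert_space)"
  by (rule bounded_linear_intro[where K = "cmod c"])
    (simp_all add: scaleC_add_right scaleR_scaleC scaleC_scaleC norm_scaleC mult.commute)

definition orthonormal_basis :: "(nat \<Rightarrow> 'a::chilbert_space) \<Rightarrow> bool" where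
  "orthonormal_basis e \<longleftrightarrow>
     (\<forall>i j. cinner (e i) (e j) = (if i = j then 1 else 0)) \<and>
     closure (complex_vector.span (range e)) = UNIV"

text \<open>
  Bounded operators are the complex-linear elements of the type of bounded real-linear
  maps; the norm, topology and composition of that type are the usual ones on operators.
\<close>

definition bounded_ops :: "('a::chilbert_space \<Rightarrow>\<^sub>L 'a) set" where
  "bounded_ops = {a. \<forall>c x. blinfun_apply a (c *\<^sub>C x) = c *\<^sub>C blinfun_apply a x}"

lift_definition scaleC_op ::
    "complex \<Rightarrow> ('a::chilbert_space \<Rightarrow>\<^sub>L 'a) \<Rightarrow> ('a \<Rightarrow>\<^sub>L 'a)"
  is "\<lambda>c a x. c *\<^sub>C a x"
  by (rule bounded_linear_compose[OF bounded_linear_scaleC])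

definition entry ::
    "(nat \<Rightarrow> 'a::chilbert_space) \<Rightarrow> ('a \<Rightarrow>\<^sub>L 'a) \<Rightarrow> nat \<Rightarrow> nat \<Rightarrow> complex" where
  "entry e a i j = cinner (blinfun_apply a (e j)) (e i)"

definition Bk :: "(nat \<Rightarrow> 'a::chilbert_space) \<Rightarrow> nat \<Rightarrow> ('a \<Rightarrow>\<^sub>L 'a) set" where
  "Bk e k = {a \<in> bounded_ops.
     (\<forall>i. finite {j. entry e a i j \<noteq> 0} \<and> card {j. entry e a i j \<noteq> 0} \<le> k) \<and>
     (\<forall>j. finite {i. entry e a i j \<noteq> 0} \<and> card {i. entry e a i j \<noteq> 0} \<le> k)}"

definition Binf :: "(nat \<Rightarrow> 'a::chilbert_space) \<Rightarrow> ('a \<Rightarrow>\<^sub>L 'a) set" where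
  "Binf e = (\<Union>k. Bk e k)"

text \<open>
  The closure is taken among bounded real-linear maps; \<^const>\<open>bounded_ops\<close> is closed there,
  so this is also the closure within \<^const>\<open>bounded_ops\<close>.
\<close>

definition Bf :: "(nat \<Rightarrow> 'a::chilbert_space) \<Rightarrow> ('a \<Rightarrow>\<^sub>L 'a) set" where
  "Bf e = closure (Binf e)"

text \<open>
  The supremum is one of real numbers. It is over a nonempty set bounded by \<open>norm a\<close> when
  \<open>e\<close> is orthonormal, so it never takes an unspecified value.
\<close>

definition IH :: "(nat \<Rightarrow> 'a::chilbert_space) \<Rightarrow> ('a \<Rightarrow>\<^sub>L 'a) set" where
  "IH e = {a \<in> Bf e.
     (\<lambda>n. SUP (i, j)\<in>{n..} \<times> {n..}. cmod (entry e a i j)) \<longlonglongrightarrow> 0}"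

definition two_sided_ideal ::
    "('a::chilbert_space \<Rightarrow>\<^sub>L 'a) set \<Rightarrow> ('a \<Rightarrow>\<^sub>L 'a) set \<Rightarrow> bool" where
  "two_sided_ideal A J \<longleftrightarrow>
     J \<subseteq> A \<and> 0 \<in> J \<and>
     (\<forall>x\<in>J. \<forall>y\<in>J. x + y \<in> J) \<and>
     (\<forall>c. \<forall>x\<in>J. scaleC_op c x \<in> J) \<and>
     (\<forall>a\<in>A. \<forall>x\<in>J. a o\<^sub>L x \<in> J \<and> x o\<^sub>L a \<in> J)"

definition proper_closed_ideal ::
    "('a::chilbert_space \<Rightarrow>\<^sub>L 'a) set \<Rightarrow> ('a \<Rightarrow>\<^sub>L 'a) set \<Rightarrow> bool" where
  "proper_closed_ideal A J \<longleftrightarrow> two_sided_ideal A J \<and> closed J \<and> J \<noteq> A"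

end

theory Submission
  imports Defs
begin

text \<open>
  Approximation by matrices with finite rows and columns shows that \<^term>\<open>IH e\<close> is an ideal
  and that every row and every column of an element of \<^term>\<open>Bf e\<close> tends to zero. If an ideal
  contains some \<open>a\<close> outside \<^term>\<open>IH e\<close>, there are \<open>\<delta> > 0\<close> and entries
  \<open>a (i k) (j k)\<close> of modulus at least \<open>\<delta>\<close> with both indices tending to infinity; after thinning
  out, the entries \<open>a (i k) (j l)\<close> with \<open>k \<noteq> l\<close> are so small that compressing \<open>a\<close> to these rows
  and columns and dividing row \<open>k\<close> by \<open>a (i k) (j k)\<close> gives an operator at distance less than \<open>1\<close>
  from the identity. Such an operator is invertible by a Neumann series, so the ideal is
  not proper.
\<close>

section \<open>Sesquilinearity of the inner product and continuity of scalar multiplication\<close>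

lemma cinner_add_right: "cinner x (y + z) = cinner x y + cinner x (z :: 'a::chilbert_space)"
  by (metis cinner_add_left cinner_commute complex_cnj_add)

lemma cinner_scaleC_right: "cinner x (c *\<^sub>C y) = cnj c * cinner x (y :: 'a::chilbert_space)"
  by (metis cinner_commute cinner_scaleC_left complex_cnj_mult)

lemma cinner_zero_left [simp]: "cinner 0 (y :: 'a::chilbert_space) = 0"
  using cinner_add_left[of 0 0 y] by simp

lemma cinner_zero_right [simp]: "cinner (x :: 'a::chilbert_space) 0 = 0"
  using cinner_add_right[of x 0 0] by simp

lemma cinner_diff_left: "cinner (x - y) z = cinner x z - cinner y (z :: 'a::chilbert_space)"
  using cinner_add_left[of "x - y" y z] by simp

lemma cinner_diff_right: "cinner x (y - z) = cinner x y - cinner x (z :: 'a::chilbert_space)"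
  using cinner_add_right[of x "y - z" z] by simp

lemma cinner_sum_left: "cinner (sum f F) y = (\<Sum>k\<in>F. cinner (f k) (y :: 'a::chilbert_space))"
  by (induction F rule: infinite_finite_induct) (simp_all add: cinner_add_left)

lemma cinner_sum_right: "cinner y (sum f F) = (\<Sum>k\<in>F. cinner y (f k :: 'a::chilbert_space))"
  by (induction F rule: infinite_finite_induct) (simp_all add: cinner_add_right)

lemma scaleC_op_apply: "blinfun_apply (scaleC_op c a) x = c *\<^sub>C blinfun_apply a x"
  by (simp add: scaleC_op.rep_eq)

lemma bounded_linear_scaleC_op:
  "bounded_linear (scaleC_op c :: ('a \<Rightarrow>\<^sub>L 'a) \<Rightarrow> ('a \<Rightarrow>\<^sub>L 'a::chilbert_space))"
proof (rule bounded_linear_intro[where K = "cmod c"])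
  fix a b :: "'a \<Rightarrow>\<^sub>L 'a" and r :: real
  show "scaleC_op c (a + b) = scaleC_op c a + scaleC_op c b"
    by (rule blinfun_eqI) (simp add: scaleC_op_apply blinfun.bilinear_simps scaleC_add_right)
  show "scaleC_op c (r *\<^sub>R a) = r *\<^sub>R scaleC_op c a"
    by (rule blinfun_eqI)
      (simp add: scaleC_op_apply blinfun.bilinear_simps scaleR_scaleC scaleC_scaleC mult.commute)
  show "norm (scaleC_op c a) \<le> norm a * cmod c"
  proof (rule norm_blinfun_bound)
    show "norm (blinfun_apply (scaleC_op c a) x) \<le> norm a * cmod c * norm x" for x
      using mult_left_mono[OF norm_blinfun[of a x], of "cmod c"]
      by (simp add: scaleC_op_apply norm_scaleC mult_ac)
  qed simp
qed

text \<open>For fixed \<open>c\<close> and \<open>x\<close>, both sides of the equation expressing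
  complex linearity are continuous in \<open>a\<close>, so the set is an intersection of closed
  sets. This makes every element of \<open>Bf e\<close> complex linear.\<close>

lemma closed_bounded_ops: "closed (bounded_ops :: ('a::chilbert_space \<Rightarrow>\<^sub>L 'a) set)"
proof -
  have "continuous_on UNIV (\<lambda>a :: 'a \<Rightarrow>\<^sub>L 'a. c *\<^sub>C blinfun_apply a x)" for c x
    by (intro bounded_linear.continuous_on[OF bounded_linear_scaleC] continuous_intros)
  then have "closed {a :: 'a \<Rightarrow>\<^sub>L 'a. \<forall>c x. blinfun_apply a (c *\<^sub>C x) = c *\<^sub>C blinfun_apply a x}"
    by (intro closed_Collect_all closed_Collect_eq continuous_intros) auto
  then show ?thesis
    by (simp add: bounded_ops_def)
qed

lemma bounded_ops_scaleC:
  "a \<in> bounded_ops \<Longrightarrow> blinfun_apply a (c *\<^sub>C x) = c *\<^sub>C blinfun_apply a x"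
  by (simp add: bounded_ops_def)

section \<open>Closed ideals and Neumann series\<close>

lemma two_sided_idealD:
  assumes "two_sided_ideal A J"
  shows "J \<subseteq> A" "0 \<in> J" "\<lbrakk>x \<in> J; y \<in> J\<rbrakk> \<Longrightarrow> x + y \<in> J" "x \<in> J \<Longrightarrow> scaleC_op c x \<in> J"
    "\<lbrakk>a \<in> A; x \<in> J\<rbrakk> \<Longrightarrow> a o\<^sub>L x \<in> J" "\<lbrakk>a \<in> A; x \<in> J\<rbrakk> \<Longrightarrow> x o\<^sub>L a \<in> J"
  using assms by (auto simp: two_sided_ideal_def)

text \<open>With \<open>r = id_blinfun - d\<close>, the products of \<open>d\<close> with the
  partial sums of the Neumann series of \<open>r\<close> stay in \<open>J\<close> and differ from
  the identity by a power of \<open>r\<close>. Closedness of \<open>J\<close> does the rest; an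
  inverse of \<open>d\<close> is never formed.\<close>

lemma closed_ideal_contains_id:
  assumes J: "two_sided_ideal A J" "closed J"
    and d: "d \<in> J" and r: "id_blinfun - d \<in> A" "norm (id_blinfun - d) < 1"
  shows "id_blinfun \<in> J"
proof -
  define r where "r = id_blinfun - d"
  \<comment> \<open>\<open>p n\<close> is the sum of \<open>r^m d\<close> over \<open>m < n\<close>,
    which telescopes to \<open>id_blinfun - r^n\<close>. Horner form makes membership in
    \<open>J\<close> a direct induction.\<close>
  define p where "p n = ((\<lambda>q. d + (r o\<^sub>L q)) ^^ n) 0" for n
  have pJ: "p n \<in> J" for n
    by (induction n) (use r d two_sided_idealD[OF J(1)] in \<open>auto simp: p_def r_def\<close>)
  \<comment> \<open>The factor \<open>norm id_blinfun\<close> stays because it is 0, not 1, on the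
    zero space.\<close>
  have bound: "norm (id_blinfun - p n) \<le> norm r ^ n * norm (id_blinfun :: 'a \<Rightarrow>\<^sub>L 'a)" for n
  proof (induction n)
    case 0
    then show ?case by (simp add: p_def)
  next
    case (Suc n)
    have "id_blinfun - p (Suc n) = r o\<^sub>L (id_blinfun - p n)"
      by (rule blinfun_eqI) (simp add: p_def r_def blinfun.bilinear_simps)
    then have "norm (id_blinfun - p (Suc n)) \<le> norm r * norm (id_blinfun - p n)"
      by (simp add: norm_blinfun_compose)
    also have "\<dots> \<le> norm r * (norm r ^ n * norm (id_blinfun :: 'a \<Rightarrow>\<^sub>L 'a))"
      by (intro mult_left_mono Suc) simp
    finally show ?case
      by (simp add: mult.assoc)
  qed
  have "(\<lambda>n. norm r ^ n * norm (id_blinfun :: 'a \<Rightarrow>\<^sub>L 'a)) \<longlonglongrightarrow> 0"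
    using r by (intro tendsto_mult_left_zero LIMSEQ_power_zero) (simp add: r_def)
  then have "(\<lambda>n. id_blinfun - p n) \<longlonglongrightarrow> 0"
    by (rule Lim_null_comparison[rotated]) (use bound in simp)
  then have "p \<longlonglongrightarrow> id_blinfun"
    using tendsto_diff[OF tendsto_const[of id_blinfun], of "\<lambda>n. id_blinfun - p n" 0] by simp
  then show ?thesis
    using closed_sequentially[OF J(2)] pJ by blast
qed

text \<open>Counts the nonzero entries in a row or column of a matrix product.\<close>

lemma card_Union_le_mult:
  assumes "finite A" "card A \<le> k" "\<And>m. m \<in> A \<Longrightarrow> card (B m) \<le> l"
  shows "card (\<Union>m\<in>A. B m) \<le> k * l"
proof -
  have "card (\<Union>m\<in>A. B m) \<le> (\<Sum>m\<in>A. card (B m))"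
    by (rule card_UN_le[OF assms(1)])
  also have "\<dots> \<le> (\<Sum>m\<in>A. l)"
    by (intro sum_mono assms(3))
  also have "\<dots> \<le> k * l"
    using assms(2) by simp
  finally show ?thesis .
qed

section \<open>Orthonormal bases: Pythagoras, Bessel, expansions and weighted shifts\<close>

locale hilbert_basis =
  fixes e :: "nat \<Rightarrow> 'a::chilbert_space"
  assumes basis: "orthonormal_basis e"
begin

lemma cinner_basis: "cinner (e i) (e j) = (if i = j then 1 else 0)"
  using basis by (simp add: orthonormal_basis_def)

lemma norm_basis [simp]: "norm (e i) = 1"
proof -
  have "complex_of_real ((norm (e i))\<^sup>2) = complex_of_real 1"
    using cinner_self[of "e i"] by (simp add: cinner_basis)
  then have "(norm (e i))\<^sup>2 = 1"
    by (simp only: of_real_eq_iff)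
  then show ?thesis
    using norm_ge_zero[of "e i"] by (simp add: power2_eq_1_iff del: norm_ge_zero)
qed

text \<open>Pythagoras: orthonormality removes the cross terms. The injective reindexing
  \<open>f\<close> allows sums along the image of a weighted shift.\<close>

lemma norm_sum_basis:
  assumes "finite F" "inj_on f F"
  shows "(norm (\<Sum>k\<in>F. c k *\<^sub>C e (f k)))\<^sup>2 = (\<Sum>k\<in>F. (cmod (c k))\<^sup>2)"
proof -
  have "(\<Sum>l\<in>F. c l * (cnj (c k) * cinner (e (f l)) (e (f k)))) = c k * cnj (c k)" if "k \<in> F" for k
  proof -
    have "(\<Sum>l\<in>F. c l * (cnj (c k) * cinner (e (f l)) (e (f k))))
        = (\<Sum>l\<in>F. if l = k then c k * cnj (c k) else 0)"
      using assms(2) that by (intro sum.cong) (auto simp: cinner_basis inj_on_def)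
    then show ?thesis
      using assms(1) that by simp
  qed
  then have "cinner (\<Sum>k\<in>F. c k *\<^sub>C e (f k)) (\<Sum>k\<in>F. c k *\<^sub>C e (f k)) = (\<Sum>k\<in>F. c k * cnj (c k))"
    by (simp add: cinner_sum_left cinner_scaleC_left cinner_sum_right cinner_scaleC_right
        sum_distrib_left mult.left_commute
        cong: sum.cong)
  then have "complex_of_real ((norm (\<Sum>k\<in>F. c k *\<^sub>C e (f k)))\<^sup>2)
      = complex_of_real (\<Sum>k\<in>F. (cmod (c k))\<^sup>2)"
    by (simp add: cinner_self complex_norm_square del: of_real_power)
  then show ?thesis
    by (simp only: of_real_eq_iff)
qed

text \<open>For the orthogonal projection \<open>s\<close> of \<open>x\<close>, the products of
  \<open>x\<close> with \<open>s\<close>, of \<open>s\<close> with \<open>x\<close> and of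
  \<open>s\<close> with itself all equal the same real number \<open>t\<close>, so expanding the
  square leaves one \<open>- t\<close>.\<close>

lemma norm_diff_projection:
  assumes "finite F"
  shows "(norm (x - (\<Sum>k\<in>F. cinner x (e k) *\<^sub>C e k)))\<^sup>2
      = (norm x)\<^sup>2 - (\<Sum>k\<in>F. (cmod (cinner x (e k)))\<^sup>2)"
proof -
  define s where "s = (\<Sum>k\<in>F. cinner x (e k) *\<^sub>C e k)"
  define t where "t = (\<Sum>k\<in>F. (cmod (cinner x (e k)))\<^sup>2)"
  have xs: "cinner x s = complex_of_real t"
    unfolding s_def t_def
    by (simp add: cinner_sum_right cinner_scaleC_right complex_norm_square mult.commute
        del: of_real_power)
  then have sx: "cinner s x = complex_of_real t"
    using cinner_commute[of s x] by simp
  have "(norm s)\<^sup>2 = t"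
    using norm_sum_basis[OF assms, of id "\<lambda>k. cinner x (e k)"] by (simp add: s_def t_def)
  then have ss: "cinner s s = complex_of_real t"
    by (simp add: cinner_self)
  have "complex_of_real ((norm (x - s))\<^sup>2) = cinner (x - s) (x - s)"
    by (simp add: cinner_self)
  also have "\<dots> = complex_of_real ((norm x)\<^sup>2 - t)"
    by (simp add: cinner_diff_left cinner_diff_right xs sx ss cinner_self[of x]
        del: of_real_power)
  finally show ?thesis
    by (simp only: of_real_eq_iff s_def t_def)
qed

lemma bessel:
  assumes "finite F" "inj_on f F"
  shows "(\<Sum>k\<in>F. (cmod (cinner x (e (f k))))\<^sup>2) \<le> (norm x)\<^sup>2"
proof -
  have "0 \<le> (norm x)\<^sup>2 - (\<Sum>k\<in>f ` F. (cmod (cinner x (e k)))\<^sup>2)"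
    unfolding norm_diff_projection[OF finite_imageI[OF assms(1)], symmetric] by simp
  then show ?thesis
    using sum.reindex[OF assms(2), of "\<lambda>k. (cmod (cinner x (e k)))\<^sup>2"] by simp
qed

lemma cmod_cinner_basis_le: "cmod (cinner x (e k)) \<le> norm x"
proof -
  have "(cmod (cinner x (e k)))\<^sup>2 \<le> (norm x)\<^sup>2"
    using bessel[of "{k}" id x] by simp
  then show ?thesis
    by (rule power2_le_imp_le) (rule norm_ge_zero)
qed

lemma bounded_linear_cinner_basis: "bounded_linear (\<lambda>x. cinner x (e k))"
proof (rule bounded_linear_intro[where K = 1])
  show "cinner (r *\<^sub>R x) (e k) = r *\<^sub>R cinner x (e k)" for r x
    unfolding scaleR_scaleC cinner_scaleC_left by (rule scaleR_conv_of_real[symmetric])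
qed (simp_all add: cinner_add_left cmod_cinner_basis_le)

text \<open>The partial sums \<open>S n\<close> eventually fix each vector of the dense span, and
  \<open>y - S n y\<close> is never longer than \<open>y\<close>. Together these carry convergence
  from the span to all of the space.\<close>

lemma basis_expansion: "(\<lambda>k. cinner x (e k) *\<^sub>C e k) sums x"
proof -
  define S where "S n y = (\<Sum>k<n. cinner y (e k) *\<^sub>C e k)" for n y
  \<comment> \<open>\<open>V\<close> is a subspace containing every basis vector, hence it contains
    the span.\<close>
  define V where "V = {y. \<exists>N. \<forall>n\<ge>N. S n y = y}"
  have S_add: "S n (y + z) = S n y + S n z" for n y z
    by (simp add: S_def cinner_add_left scaleC_add_left sum.distrib)
  have S_diff: "S n (y - z) = S n y - S n z" for n y z
    using S_add[of n "y - z" z] by simp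
  have S_scale: "S n (c *\<^sub>C y) = c *\<^sub>C S n y" for n c y
    by (simp add: S_def cinner_scaleC_left scaleC_scaleC complex_vector.scale_sum_right)
  have contraction: "norm (y - S n y) \<le> norm y" for n y
  proof -
    have "(norm (y - S n y))\<^sup>2 \<le> (norm y)\<^sup>2"
      unfolding S_def by (subst norm_diff_projection) (simp_all add: sum_nonneg)
    then show ?thesis
      by (rule power2_le_imp_le) simp
  qed
  have "complex_vector.subspace V"
  proof (rule complex_vector.subspaceI)
    show "0 \<in> V"
      by (simp add: V_def S_def)
    show "y + z \<in> V" if yz: "y \<in> V" "z \<in> V" for y z
    proof -
      obtain M N where "\<forall>n\<ge>M. S n y = y" "\<forall>n\<ge>N. S n z = z"
        using yz by (auto simp: V_def)
      then have "\<forall>n\<ge>max M N. S n (y + z) = y + z"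
        by (simp add: S_add)
      then show ?thesis
        unfolding V_def by blast
    qed
    show "c *\<^sub>C y \<in> V" if "y \<in> V" for c y
      using that by (auto simp: V_def S_scale)
  qed
  moreover have "range e \<subseteq> V"
  proof clarify
    fix i
    have "S n (e i) = e i" if "n \<ge> Suc i" for n
    proof -
      have "S n (e i) = (\<Sum>k<n. if k = i then e i else 0)"
        unfolding S_def by (intro sum.cong) (auto simp: cinner_basis scaleC_one)
      then show ?thesis
        using that by simp
    qed
    then show "e i \<in> V"
      unfolding V_def by blast
  qed
  ultimately have span: "complex_vector.span (range e) \<subseteq> V"
    by (rule complex_vector.span_minimal[rotated])
  have "(\<lambda>n. S n x) \<longlonglongrightarrow> x"
  proof (rule LIMSEQ_I)
    fix \<epsilon> :: real
    assume "0 < \<epsilon>"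
    moreover have "x \<in> closure (complex_vector.span (range e))"
      using basis by (simp add: orthonormal_basis_def)
    ultimately obtain y where y: "y \<in> complex_vector.span (range e)" "dist y x < \<epsilon>"
      by (meson closure_approachable)
    then obtain N where N: "\<And>n. n \<ge> N \<Longrightarrow> S n y = y"
      using span by (auto simp: V_def)
    have "norm (S n x - x) < \<epsilon>" if "n \<ge> N" for n
    proof -
      \<comment> \<open>As \<open>S n\<close> fixes \<open>y\<close>, subtracting \<open>y\<close>
        from \<open>x\<close> leaves the error unchanged, and the contraction bound applies to
        \<open>x - y\<close>.\<close>
      have "norm (S n x - x) = norm ((x - y) - S n (x - y))"
        using N[OF that] by (simp add: S_diff norm_minus_commute)
      also have "\<dots> \<le> norm (x - y)"
        by (rule contraction)
      finally show ?thesis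
        using y(2) by (simp add: dist_norm norm_minus_commute)
    qed
    then show "\<exists>N. \<forall>n\<ge>N. norm (S n x - x) < \<epsilon>"
      by blast
  qed
  then show ?thesis
    by (simp add: sums_def S_def)
qed

text \<open>The easy half of Riesz-Fischer: by Pythagoras, blocks of the vector series are as small
  as those of the series of squares, so completeness applies.\<close>

lemma summable_basis:
  assumes "summable (\<lambda>k. (cmod (c k))\<^sup>2)" "inj f"
  shows "summable (\<lambda>k. c k *\<^sub>C e (f k))"
  unfolding summable_Cauchy
proof (intro allI impI)
  fix \<epsilon> :: real
  assume \<epsilon>: "0 < \<epsilon>"
  then obtain N where N: "\<And>m n. m \<ge> N \<Longrightarrow> norm (\<Sum>k=m..<n. (cmod (c k))\<^sup>2) < \<epsilon>\<^sup>2"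
    using assms(1) unfolding summable_Cauchy by (meson zero_less_power)
  have "norm (\<Sum>k=m..<n. c k *\<^sub>C e (f k)) < \<epsilon>" if "m \<ge> N" for m n
  proof -
    have "(norm (\<Sum>k=m..<n. c k *\<^sub>C e (f k)))\<^sup>2 < \<epsilon>\<^sup>2"
      using N[OF that, of n] assms(2)
      by (subst norm_sum_basis) (auto intro: inj_on_subset simp: sum_nonneg)
    then show ?thesis
      by (rule power2_less_imp_less) (use \<epsilon> in simp)
  qed
  then show "\<exists>N. \<forall>m\<ge>N. \<forall>n. norm (\<Sum>k=m..<n. c k *\<^sub>C e (f k)) < \<epsilon>"
    by blast
qed

text \<open>The operator sends \<open>e (g k)\<close> to \<open>w k\<close> times
  \<open>e (f k)\<close> and kills the basis vectors indexed outside the range of \<open>g\<close>.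
  Its instances select rows and columns of a matrix by composition.\<close>

lemma exists_weighted_shift:
  assumes f: "inj f" and g: "inj g" and W: "\<And>k. cmod (w k) \<le> W"
  obtains T where "T \<in> bounded_ops"
    "\<And>x. (\<lambda>k. (w k * cinner x (e (g k))) *\<^sub>C e (f k)) sums blinfun_apply T x"
proof -
  let ?c = "\<lambda>x k. w k * cinner x (e (g k))"
  have W0: "0 \<le> W"
    by (rule order_trans[OF norm_ge_zero W[of 0]])
  have term_le: "(cmod (?c x k))\<^sup>2 \<le> W\<^sup>2 * (cmod (cinner x (e (g k))))\<^sup>2" for x k
    using W[of k] by (simp add: norm_mult power_mult_distrib mult_right_mono power_mono)
  \<comment> \<open>Bessel bounds the coefficients uniformly in \<open>n\<close>; the bound yields
    both convergence of the series and boundedness of its sum.\<close>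
  have partial: "(\<Sum>k<n. (cmod (?c x k))\<^sup>2) \<le> (W * norm x)\<^sup>2" for x n
  proof -
    have "(\<Sum>k<n. (cmod (?c x k))\<^sup>2) \<le> W\<^sup>2 * (\<Sum>k<n. (cmod (cinner x (e (g k))))\<^sup>2)"
      unfolding sum_distrib_left by (intro sum_mono term_le)
    also have "\<dots> \<le> W\<^sup>2 * (norm x)\<^sup>2"
      using bessel[of "{..<n}" g x] g by (intro mult_left_mono) (auto intro: inj_on_subset)
    finally show ?thesis
      by (simp add: power_mult_distrib)
  qed
  define t where "t x = (\<Sum>k. ?c x k *\<^sub>C e (f k))" for x
  have t: "(\<lambda>k. ?c x k *\<^sub>C e (f k)) sums t x" for x
    unfolding t_def using partial[of x] f
    by (intro summable_sums summable_basis summableI_nonneg_bounded[where x = "(W * norm x)\<^sup>2"]) auto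
  have add: "t (x + y) = t x + t y" for x y
    using sums_add[OF t t, of x y] t[of "x + y"]
    by (simp add: cinner_add_left distrib_left scaleC_add_left sums_unique2)
  have scale: "t (c *\<^sub>C x) = c *\<^sub>C t x" for c x
    using bounded_linear.sums[OF bounded_linear_scaleC t, of c x] t[of "c *\<^sub>C x"]
    by (simp add: cinner_scaleC_left scaleC_scaleC mult.left_commute sums_unique2)
  have norm: "norm (t x) \<le> norm x * W" for x
  proof (rule Lim_norm_ubound)
    show "(\<lambda>n. \<Sum>k<n. ?c x k *\<^sub>C e (f k)) \<longlonglongrightarrow> t x"
      using t by (simp add: sums_def)
    have "norm (\<Sum>k<n. ?c x k *\<^sub>C e (f k)) \<le> W * norm x" for n
    proof (rule power2_le_imp_le)
      show "(norm (\<Sum>k<n. ?c x k *\<^sub>C e (f k)))\<^sup>2 \<le> (W * norm x)\<^sup>2"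
        using partial[of x n] f by (subst norm_sum_basis) (auto intro: inj_on_subset)
    qed (simp add: W0)
    then show "\<forall>\<^sub>F n in sequentially. norm (\<Sum>k<n. ?c x k *\<^sub>C e (f k)) \<le> norm x * W"
      by (simp add: mult.commute[of _ W])
  qed simp
  have "bounded_linear t"
    by (rule bounded_linear_intro[where K = W, OF add _ norm]) (simp only: scaleR_scaleC scale)
  then have T: "blinfun_apply (Blinfun t) = t"
    by (rule bounded_linear_Blinfun_apply)
  show ?thesis
    by (rule that[of "Blinfun t"]) (use T t scale in \<open>simp_all add: bounded_ops_def\<close>)
qed

section \<open>Matrix entries and norm estimates\<close>

lemma cmod_entry_le: "cmod (entry e a i j) \<le> norm a"
  using cmod_cinner_basis_le[of "blinfun_apply a (e j)" i] norm_blinfun[of a "e j"]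
  by (simp add: entry_def)

lemma entry_add: "entry e (a + b) i j = entry e a i j + entry e b i j"
  by (simp add: entry_def blinfun.bilinear_simps cinner_add_left)

lemma entry_diff: "entry e (a - b) i j = entry e a i j - entry e b i j"
  by (simp add: entry_def blinfun.bilinear_simps cinner_diff_left)

lemma entry_scaleC_op: "entry e (scaleC_op c a) i j = c * entry e a i j"
  by (simp add: entry_def scaleC_op_apply cinner_scaleC_left)

lemma entry_id: "entry e id_blinfun i j = (if i = j then 1 else 0)"
  by (simp add: entry_def cinner_basis)

lemma entry_zero: "entry e 0 i j = 0"
  by (simp add: entry_def)

lemma apply_expansion:
  assumes "a \<in> bounded_ops"
  shows "(\<lambda>m. cinner x (e m) *\<^sub>C blinfun_apply a (e m)) sums blinfun_apply a x"
  using bounded_linear.sums[OF blinfun.bounded_linear_right[of a] basis_expansion[of x]]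
  by (simp add: bounded_ops_scaleC[OF assms])

text \<open>The matrix product formula, as an infinite series: the expansion of
  \<open>b (e j)\<close> is pushed through \<open>a\<close> and then through the bounded functional
  given by \<open>e i\<close>.\<close>

lemma entry_compose:
  assumes "a \<in> bounded_ops"
  shows "(\<lambda>m. entry e a i m * entry e b m j) sums entry e (a o\<^sub>L b) i j"
  using bounded_linear.sums[OF bounded_linear_cinner_basis[of i]
      apply_expansion[OF assms, of "blinfun_apply b (e j)"]]
  by (simp add: entry_def cinner_scaleC_left mult.commute)

text \<open>A crude bound by absolute summation: column \<open>l\<close> has norm at most
  \<open>U * v l\<close>, and every coordinate of \<open>x\<close> is at most \<open>norm x\<close>.
  It is sharp enough for matrices with geometrically decaying entries.\<close>

lemma norm_le_sum_entries:
  assumes a: "a \<in> bounded_ops" and le: "\<And>k l. cmod (entry e a k l) \<le> u k * v l"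
    and u: "u sums U" and v: "v sums V" and v0: "\<And>l. 0 \<le> v l"
  shows "norm a \<le> U * V"
proof -
  have column: "norm (blinfun_apply a (e l)) \<le> U * v l" for l
  proof (rule norm_sums_le[OF basis_expansion sums_mult2[OF u]])
    show "norm (cinner (blinfun_apply a (e l)) (e k) *\<^sub>C e k) \<le> u k * v l" for k
      using le[of k l] by (simp add: entry_def norm_scaleC)
  qed
  have "norm (blinfun_apply a x) \<le> (U * V) * norm x" for x
  proof (rule norm_sums_le[OF apply_expansion[OF a] sums_mult2[OF sums_mult[OF v]]])
    show "norm (cinner x (e l) *\<^sub>C blinfun_apply a (e l)) \<le> (U * v l) * norm x" for l
      unfolding norm_scaleC mult.commute[of _ "norm x"]
      by (rule mult_mono[OF cmod_cinner_basis_le column]) auto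
  qed
  \<comment> \<open>The operator bound needs a nonnegative constant. Each \<open>U * v l\<close>
    dominates the norm of a column, and these numbers sum to \<open>U * V\<close>.\<close>
  moreover have "0 \<le> U * V"
  proof -
    have "0 \<le> U * v l" for l
      by (rule order_trans[OF norm_ge_zero column])
    then show ?thesis
      by (rule sums_le[OF _ sums_zero sums_mult[OF v]])
  qed
  ultimately show ?thesis
    by (rule norm_blinfun_bound[rotated])
qed

section \<open>Matrices with finite rows and columns and the algebra \<open>Bf e\<close>\<close>

lemma Binf_subset: "Binf e \<subseteq> bounded_ops"
  by (auto simp: Binf_def Bk_def)

lemma Bf_subset: "Bf e \<subseteq> bounded_ops"
  unfolding Bf_def by (rule closure_minimal[OF Binf_subset closed_bounded_ops])

lemma Binf_subset_Bf: "Binf e \<subseteq> Bf e"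
  unfolding Bf_def by (rule closure_subset)

lemma Binf_supportE:
  assumes "a \<in> Binf e"
  obtains k where "\<And>i. finite {j. entry e a i j \<noteq> 0}" "\<And>i. card {j. entry e a i j \<noteq> 0} \<le> k"
    "\<And>j. finite {i. entry e a i j \<noteq> 0}" "\<And>j. card {i. entry e a i j \<noteq> 0} \<le> k"
  using assms by (auto simp: Binf_def Bk_def)

text \<open>The first \<open>M\<close> rows and columns together hold finitely many nonzero entries,
  so one \<open>N\<close> lies beyond them all.\<close>

lemma Binf_entries_far_zeroE:
  assumes "a \<in> Binf e"
  obtains N where "\<And>m n. \<lbrakk>m < M; N \<le> n\<rbrakk> \<Longrightarrow> entry e a m n = 0"
    "\<And>m n. \<lbrakk>m < M; N \<le> n\<rbrakk> \<Longrightarrow> entry e a n m = 0"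
proof -
  define S where "S = (\<Union>m<M. {n. entry e a m n \<noteq> 0} \<union> {n. entry e a n m \<noteq> 0})"
  have "finite S"
    unfolding S_def using Binf_supportE[OF assms]
    by (metis (no_types, lifting) finite_UN finite_Un finite_lessThan)
  then obtain N where N: "\<And>n. n \<in> S \<Longrightarrow> n < N"
    unfolding finite_nat_set_iff_bounded by auto
  have far: "entry e a m n = 0 \<and> entry e a n m = 0" if "m < M" "N \<le> n" for m n
  proof -
    have "n \<notin> S"
      using N[of n] that(2) by auto
    then show ?thesis
      using that(1) by (auto simp: S_def)
  qed
  show ?thesis
    by (rule that[of N]) (simp_all add: far)
qed

text \<open>Supports need only be covered by small finite sets, which spares computing them exactly
  for sums and products.\<close>

lemma BinfI:
  assumes "a \<in> bounded_ops"
    and "\<And>i. \<exists>F. finite F \<and> card F \<le> k \<and> {j. entry e a i j \<noteq> 0} \<subseteq> F"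
    and "\<And>j. \<exists>F. finite F \<and> card F \<le> k \<and> {i. entry e a i j \<noteq> 0} \<subseteq> F"
  shows "a \<in> Binf e"
proof -
  have *: "finite S \<and> card S \<le> k" if S: "\<exists>F. finite F \<and> card F \<le> k \<and> S \<subseteq> F"
    for S :: "nat set"
  proof -
    obtain F where "finite F" "card F \<le> k" "S \<subseteq> F"
      using S by blast
    then show ?thesis
      using finite_subset[of S F] card_mono[of F S] by simp
  qed
  have "a \<in> Bk e k"
    unfolding Bk_def using assms(1) *[OF assms(2)] *[OF assms(3)] by blast
  then show ?thesis
    unfolding Binf_def by blast
qed

lemma Binf_add:
  assumes a: "a \<in> Binf e" and b: "b \<in> Binf e"
  shows "a + b \<in> Binf e"
proof -
  obtain k where k: "\<And>i. finite {j. entry e a i j \<noteq> 0}" "\<And>i. card {j. entry e a i j \<noteq> 0} \<le> k"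
    "\<And>j. finite {i. entry e a i j \<noteq> 0}" "\<And>j. card {i. entry e a i j \<noteq> 0} \<le> k"
    using Binf_supportE[OF a] by blast
  obtain l where l: "\<And>i. finite {j. entry e b i j \<noteq> 0}" "\<And>i. card {j. entry e b i j \<noteq> 0} \<le> l"
    "\<And>j. finite {i. entry e b i j \<noteq> 0}" "\<And>j. card {i. entry e b i j \<noteq> 0} \<le> l"
    using Binf_supportE[OF b] by blast
  show ?thesis
  proof (rule BinfI)
    show "a + b \<in> bounded_ops"
      using a b Binf_subset
      by (auto simp: bounded_ops_def blinfun.bilinear_simps scaleC_add_right subset_iff)
    show "\<exists>F. finite F \<and> card F \<le> k + l \<and> {j. entry e (a + b) i j \<noteq> 0} \<subseteq> F" for i
      using k(1,2)[of i] l(1,2)[of i]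
      by (intro exI[of _ "{j. entry e a i j \<noteq> 0} \<union> {j. entry e b i j \<noteq> 0}"])
        (auto simp: entry_add intro: order_trans[OF card_Un_le add_mono])
    show "\<exists>F. finite F \<and> card F \<le> k + l \<and> {i. entry e (a + b) i j \<noteq> 0} \<subseteq> F" for j
      using k(3,4)[of j] l(3,4)[of j]
      by (intro exI[of _ "{i. entry e a i j \<noteq> 0} \<union> {i. entry e b i j \<noteq> 0}"])
        (auto simp: entry_add intro: order_trans[OF card_Un_le add_mono])
  qed
qed

lemma Binf_scaleC_op:
  assumes "a \<in> Binf e"
  shows "scaleC_op c a \<in> Binf e"
proof -
  obtain k where k: "\<And>i. finite {j. entry e a i j \<noteq> 0}" "\<And>i. card {j. entry e a i j \<noteq> 0} \<le> k"
    "\<And>j. finite {i. entry e a i j \<noteq> 0}" "\<And>j. card {i. entry e a i j \<noteq> 0} \<le> k"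
    using Binf_supportE[OF assms] by blast
  show ?thesis
  proof (rule BinfI)
    show "scaleC_op c a \<in> bounded_ops"
      using assms Binf_subset
      by (auto simp: bounded_ops_def scaleC_op_apply scaleC_scaleC mult.commute subset_iff)
    show "\<exists>F. finite F \<and> card F \<le> k \<and> {j. entry e (scaleC_op c a) i j \<noteq> 0} \<subseteq> F" for i
      using k(1,2)[of i] by (intro exI[of _ "{j. entry e a i j \<noteq> 0}"]) (auto simp: entry_scaleC_op)
    show "\<exists>F. finite F \<and> card F \<le> k \<and> {i. entry e (scaleC_op c a) i j \<noteq> 0} \<subseteq> F" for j
      using k(3,4)[of j] by (intro exI[of _ "{i. entry e a i j \<noteq> 0}"]) (auto simp: entry_scaleC_op)
  qed
qed

lemma entry_compose_nonzeroE:
  assumes "a \<in> bounded_ops" "entry e (a o\<^sub>L b) i j \<noteq> 0"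
  obtains m where "entry e a i m \<noteq> 0" "entry e b m j \<noteq> 0"
proof -
  have "\<exists>m. entry e a i m * entry e b m j \<noteq> 0"
  proof (rule ccontr)
    assume "\<not> ?thesis"
    then have "(\<lambda>m. entry e a i m * entry e b m j) = (\<lambda>_. 0)"
      by blast
    then show False
      using entry_compose[OF assms(1), of i b j] assms(2) sums_unique2[OF sums_zero] by metis
  qed
  then show ?thesis
    using that by auto
qed

text \<open>Row \<open>i\<close> of the product is supported in the union of the at most
  \<open>k\<close> rows of \<open>b\<close> selected by row \<open>i\<close> of \<open>a\<close>,
  each with at most \<open>l\<close> nonzero entries; columns are symmetric.\<close>

lemma Binf_compose:
  assumes a: "a \<in> Binf e" and b: "b \<in> Binf e"
  shows "a o\<^sub>L b \<in> Binf e"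
proof -
  obtain k where k: "\<And>i. finite {j. entry e a i j \<noteq> 0}" "\<And>i. card {j. entry e a i j \<noteq> 0} \<le> k"
    "\<And>j. finite {i. entry e a i j \<noteq> 0}" "\<And>j. card {i. entry e a i j \<noteq> 0} \<le> k"
    using Binf_supportE[OF a] by blast
  obtain l where l: "\<And>i. finite {j. entry e b i j \<noteq> 0}" "\<And>i. card {j. entry e b i j \<noteq> 0} \<le> l"
    "\<And>j. finite {i. entry e b i j \<noteq> 0}" "\<And>j. card {i. entry e b i j \<noteq> 0} \<le> l"
    using Binf_supportE[OF b] by blast
  have ops: "a \<in> bounded_ops" "b \<in> bounded_ops"
    using a b Binf_subset by auto
  show ?thesis
  proof (rule BinfI)
    show "a o\<^sub>L b \<in> bounded_ops"
      using ops by (simp add: bounded_ops_def)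
    show "\<exists>F. finite F \<and> card F \<le> k * l \<and> {j. entry e (a o\<^sub>L b) i j \<noteq> 0} \<subseteq> F" for i
      using k(1,2)[of i] l(1,2)
      by (intro exI[of _ "\<Union>m\<in>{m. entry e a i m \<noteq> 0}. {j. entry e b m j \<noteq> 0}"])
        (auto intro: card_Union_le_mult elim!: entry_compose_nonzeroE[OF ops(1)])
    show "\<exists>F. finite F \<and> card F \<le> k * l \<and> {i. entry e (a o\<^sub>L b) i j \<noteq> 0} \<subseteq> F" for j
      using k(3,4) l(3,4)[of j]
      by (intro exI[of _ "\<Union>m\<in>{m. entry e b m j \<noteq> 0}. {i. entry e a i m \<noteq> 0}"])
        (auto simp: mult.commute[of k] intro: card_Union_le_mult
          elim!: entry_compose_nonzeroE[OF ops(1)])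
  qed
qed

text \<open>Approximating sequences are combined termwise. The closure properties under scaling and
  composition below follow the same pattern, by continuity of these operations.\<close>

lemma Bf_add:
  assumes "a \<in> Bf e" "b \<in> Bf e"
  shows "a + b \<in> Bf e"
proof -
  obtain s t where "\<And>n. s n \<in> Binf e" "s \<longlonglongrightarrow> a" "\<And>n. t n \<in> Binf e" "t \<longlonglongrightarrow> b"
    using assms unfolding Bf_def closure_sequential by blast
  then show ?thesis
    unfolding Bf_def closure_sequential
    by (intro exI[of _ "\<lambda>n. s n + t n"]) (auto intro: Binf_add tendsto_add)
qed

lemma Bf_scaleC_op:
  assumes "a \<in> Bf e"
  shows "scaleC_op c a \<in> Bf e"
proof -
  obtain s where "\<And>n. s n \<in> Binf e" "s \<longlonglongrightarrow> a"
    using assms unfolding Bf_def closure_sequential by blast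
  then show ?thesis
    unfolding Bf_def closure_sequential
    by (intro exI[of _ "\<lambda>n. scaleC_op c (s n)"])
      (auto intro: Binf_scaleC_op bounded_linear.tendsto[OF bounded_linear_scaleC_op])
qed

lemma Bf_compose:
  assumes "a \<in> Bf e" "b \<in> Bf e"
  shows "a o\<^sub>L b \<in> Bf e"
proof -
  obtain s t where "\<And>n. s n \<in> Binf e" "s \<longlonglongrightarrow> a" "\<And>n. t n \<in> Binf e" "t \<longlonglongrightarrow> b"
    using assms unfolding Bf_def closure_sequential by blast
  then show ?thesis
    unfolding Bf_def closure_sequential
    by (intro exI[of _ "\<lambda>n. s n o\<^sub>L t n"])
      (auto intro: Binf_compose bounded_bilinear.tendsto[OF bounded_bilinear_blinfun_compose])
qed

lemma id_in_Bf: "id_blinfun \<in> Bf e"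
proof -
  have "id_blinfun \<in> Binf e"
  proof (rule BinfI[where k = 1])
    show "\<exists>F. finite F \<and> card F \<le> 1 \<and> {j. entry e id_blinfun i j \<noteq> 0} \<subseteq> F" for i
      by (intro exI[of _ "{i}"]) (auto simp: entry_id)
    show "\<exists>F. finite F \<and> card F \<le> 1 \<and> {i. entry e id_blinfun i j \<noteq> 0} \<subseteq> F" for j
      by (intro exI[of _ "{j}"]) (auto simp: entry_id)
  qed (simp add: bounded_ops_def)
  then show ?thesis
    using Binf_subset_Bf by blast
qed

lemma Bf_diff:
  assumes "a \<in> Bf e" "b \<in> Bf e"
  shows "a - b \<in> Bf e"
proof -
  have "scaleC_op (- 1) b = - b"
    by (rule blinfun_eqI)
      (simp add: scaleC_op_apply blinfun.bilinear_simps scaleC_one)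
  then show ?thesis
    using Bf_add[OF assms(1) Bf_scaleC_op[OF assms(2), of "- 1"]] by simp
qed

lemma Bf_approx:
  assumes "a \<in> Bf e" "0 < \<epsilon>"
  obtains b where "b \<in> Binf e" "norm (a - b) < \<epsilon>"
  using assms unfolding Bf_def closure_approachable by (metis dist_norm norm_minus_commute)

text \<open>Entries are bounded by the operator norm, so wherever a close approximant from
  \<open>Binf e\<close> has entry zero, the entry of \<open>a\<close> is below \<epsilon>.\<close>

lemma Bf_entries_far_small:
  assumes a: "a \<in> Bf e" and \<epsilon>: "0 < \<epsilon>"
  obtains N where "\<And>m n. \<lbrakk>m < M; N \<le> n\<rbrakk> \<Longrightarrow> cmod (entry e a m n) < \<epsilon>"
    "\<And>m n. \<lbrakk>m < M; N \<le> n\<rbrakk> \<Longrightarrow> cmod (entry e a n m) < \<epsilon>"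
proof -
  obtain b where b: "b \<in> Binf e" "norm (a - b) < \<epsilon>"
    using Bf_approx[OF a \<epsilon>] .
  obtain N where N: "\<And>m n. \<lbrakk>m < M; N \<le> n\<rbrakk> \<Longrightarrow> entry e b m n = 0"
    "\<And>m n. \<lbrakk>m < M; N \<le> n\<rbrakk> \<Longrightarrow> entry e b n m = 0"
    by (rule Binf_entries_far_zeroE[OF b(1)]) (rule that)
  have small: "cmod (entry e a i j) < \<epsilon>" if "entry e b i j = 0" for i j
    using cmod_entry_le[of "a - b" i j] b(2) that by (simp add: entry_diff)
  show ?thesis
  proof (rule that[of N])
    fix m n
    assume "m < M" "N \<le> n"
    then show "cmod (entry e a m n) < \<epsilon>" "cmod (entry e a n m) < \<epsilon>"
      using N[of m n] by (auto intro!: small)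
  qed
qed

section \<open>The proper closed ideal \<open>IH e\<close>\<close>

lemma IH_iff:
  "a \<in> IH e \<longleftrightarrow> a \<in> Bf e \<and> (\<forall>\<epsilon>>0. \<exists>N. \<forall>i\<ge>N. \<forall>j\<ge>N. cmod (entry e a i j) \<le> \<epsilon>)"
proof -
  define s where "s n = (SUP (i, j)\<in>{n..} \<times> {n..}. cmod (entry e a i j))" for n
  \<comment> \<open>Without an upper bound the real supremum would be an unspecified value;
    \<open>norm a\<close> provides one.\<close>
  have bdd: "bdd_above ((\<lambda>(i, j). cmod (entry e a i j)) ` ({n..} \<times> {n..}))" for n :: nat
    by (rule bdd_aboveI2[of _ _ "norm a"]) (auto simp: cmod_entry_le)
  have le: "cmod (entry e a i j) \<le> s n" if "i \<ge> n" "j \<ge> n" for i j n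
    unfolding s_def using that cSUP_upper[OF _ bdd, of "(i, j)" n] by auto
  have s_le: "s n \<le> \<epsilon>" if "\<And>i j. \<lbrakk>i \<ge> n; j \<ge> n\<rbrakk> \<Longrightarrow> cmod (entry e a i j) \<le> \<epsilon>" for n \<epsilon>
    unfolding s_def using that by (intro cSUP_least) auto
  have s0: "0 \<le> s n" for n
    by (rule order_trans[OF norm_ge_zero le[of n n n]]) simp_all
  have "s \<longlonglongrightarrow> 0 \<longleftrightarrow> (\<forall>\<epsilon>>0. \<exists>N. \<forall>i\<ge>N. \<forall>j\<ge>N. cmod (entry e a i j) \<le> \<epsilon>)" (is "_ \<longleftrightarrow> ?R")
  proof
    assume lim: "s \<longlonglongrightarrow> 0"
    show ?R
    proof (intro allI impI)
      fix \<epsilon> :: real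
      assume "0 < \<epsilon>"
      then obtain N where "s N < \<epsilon>"
        using LIMSEQ_D[OF lim, of \<epsilon>] s0 by auto
      then show "\<exists>N. \<forall>i\<ge>N. \<forall>j\<ge>N. cmod (entry e a i j) \<le> \<epsilon>"
        using le by (meson less_imp_le order_trans)
    qed
  next
    assume R: ?R
    show "s \<longlonglongrightarrow> 0"
    proof (rule LIMSEQ_I)
      fix \<epsilon> :: real
      assume "0 < \<epsilon>"
      then obtain N where N: "\<forall>i\<ge>N. \<forall>j\<ge>N. cmod (entry e a i j) \<le> \<epsilon> / 2"
        using R half_gt_zero by blast
      have "norm (s n - 0) < \<epsilon>" if "n \<ge> N" for n
      proof -
        have "s n \<le> \<epsilon> / 2"
          using N that by (intro s_le) auto
        then show ?thesis
          using s0[of n] \<open>0 < \<epsilon>\<close> by simp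
      qed
      then show "\<exists>N. \<forall>n\<ge>N. norm (s n - 0) < \<epsilon>"
        by blast
    qed
  qed
  then show ?thesis
    by (simp add: IH_def s_def[abs_def])
qed

lemma IH_entryE:
  assumes "a \<in> IH e" "0 < \<epsilon>"
  obtains N where "\<And>i j. \<lbrakk>N \<le> i; N \<le> j\<rbrakk> \<Longrightarrow> cmod (entry e a i j) \<le> \<epsilon>"
  using assms unfolding IH_iff by blast

text \<open>Norm convergence controls all entries at once, so the threshold of a single close
  \<open>s n\<close> also serves the limit.\<close>

lemma closed_IH: "closed (IH e)"
  unfolding closed_sequential_limits
proof (intro allI impI, elim conjE)
  fix s a
  assume s: "\<forall>n. s n \<in> IH e" and lim: "s \<longlonglongrightarrow> a"
  have "s n \<in> Bf e" for n
    using s IH_iff by blast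
  then have "a \<in> Bf e"
    using closed_sequentially[of "Bf e" s a] lim by (simp add: Bf_def)
  moreover have "\<exists>N. \<forall>i\<ge>N. \<forall>j\<ge>N. cmod (entry e a i j) \<le> \<epsilon>" if "0 < \<epsilon>" for \<epsilon>
  proof -
    obtain n where n: "norm (s n - a) < \<epsilon> / 2"
      using LIMSEQ_D[OF lim, of "\<epsilon> / 2"] \<open>0 < \<epsilon>\<close> by auto
    obtain N where N: "\<And>i j. \<lbrakk>N \<le> i; N \<le> j\<rbrakk> \<Longrightarrow> cmod (entry e (s n) i j) \<le> \<epsilon> / 2"
      using IH_entryE[of "s n" "\<epsilon> / 2"] s \<open>0 < \<epsilon>\<close> by auto
    have "cmod (entry e a i j) \<le> \<epsilon>" if "i \<ge> N" "j \<ge> N" for i j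
    proof -
      have "cmod (entry e a i j) \<le> cmod (entry e (s n) i j) + cmod (entry e (s n - a) i j)"
        by (simp add: entry_diff norm_triangle_sub norm_minus_commute)
      then show ?thesis
        using N[OF that] cmod_entry_le[of "s n - a" i j] n by linarith
    qed
    then show ?thesis
      by blast
  qed
  ultimately show "a \<in> IH e"
    by (simp add: IH_iff)
qed

lemma IH_add:
  assumes "a \<in> IH e" "b \<in> IH e"
  shows "a + b \<in> IH e"
  unfolding IH_iff
proof (intro conjI allI impI)
  show "a + b \<in> Bf e"
    using assms Bf_add by (simp add: IH_iff)
  fix \<epsilon> :: real
  assume "0 < \<epsilon>"
  then have "0 < \<epsilon> / 2"
    by simp
  obtain M where M: "\<And>i j. \<lbrakk>M \<le> i; M \<le> j\<rbrakk> \<Longrightarrow> cmod (entry e a i j) \<le> \<epsilon> / 2"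
    by (rule IH_entryE[OF assms(1) \<open>0 < \<epsilon> / 2\<close>]) (rule that)
  obtain N where N: "\<And>i j. \<lbrakk>N \<le> i; N \<le> j\<rbrakk> \<Longrightarrow> cmod (entry e b i j) \<le> \<epsilon> / 2"
    by (rule IH_entryE[OF assms(2) \<open>0 < \<epsilon> / 2\<close>]) (rule that)
  have "cmod (entry e (a + b) i j) \<le> \<epsilon>" if "max M N \<le> i" "max M N \<le> j" for i j
    using M[of i j] N[of i j] that norm_triangle_ineq[of "entry e a i j" "entry e b i j"]
    by (simp add: entry_add)
  then show "\<exists>N. \<forall>i\<ge>N. \<forall>j\<ge>N. cmod (entry e (a + b) i j) \<le> \<epsilon>"
    by blast
qed

text \<open>Let \<open>b\<close> in \<open>Binf e\<close> approximate \<open>a\<close>. An entry of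
  \<open>b x\<close> or \<open>x b\<close> is a sum of at most \<open>k\<close> terms, and far out
  these terms involve only far entries of \<open>x\<close>, which are small; the error from
  \<open>a - b\<close> is small in norm. Both sides share one choice of \<open>b\<close> and of
  thresholds.\<close>

lemma IH_compose:
  assumes a: "a \<in> Bf e" and x: "x \<in> IH e"
  shows IH_compose_left: "a o\<^sub>L x \<in> IH e" and IH_compose_right: "x o\<^sub>L a \<in> IH e"
proof -
  have xBf: "x \<in> Bf e"
    using x by (simp add: IH_iff)
  have xops: "x \<in> bounded_ops"
    using xBf Bf_subset by blast
  have main: "\<exists>N. \<forall>i\<ge>N. \<forall>j\<ge>N. cmod (entry e (a o\<^sub>L x) i j) \<le> \<epsilon> \<and> cmod (entry e (x o\<^sub>L a) i j) \<le> \<epsilon>"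
    if \<epsilon>: "0 < \<epsilon>" for \<epsilon>
  proof -
    \<comment> \<open>Adding 1 keeps the denominator positive when \<open>x\<close> is zero; the
      same device appears in \<theta>.\<close>
    define \<eta> where "\<eta> = \<epsilon> / (2 * (norm x + 1))"
    have \<eta>: "0 < \<eta>" "\<eta> * norm x \<le> \<epsilon> / 2"
      using \<epsilon> by (auto simp: \<eta>_def field_simps add_pos_nonneg)
    obtain b where b: "b \<in> Binf e" "norm (a - b) < \<eta>"
      using Bf_approx[OF a \<eta>(1)] .
    obtain k where k: "\<And>i. finite {j. entry e b i j \<noteq> 0}" "\<And>i. card {j. entry e b i j \<noteq> 0} \<le> k"
      "\<And>j. finite {i. entry e b i j \<noteq> 0}" "\<And>j. card {i. entry e b i j \<noteq> 0} \<le> k"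
      using Binf_supportE[OF b(1)] by blast
    \<comment> \<open>Chosen so that \<open>k\<close> terms of size \<open>norm b * \<theta>\<close>
      add up to at most half of \<epsilon>.\<close>
    define \<theta> where "\<theta> = \<epsilon> / (2 * (real k + 1) * (norm b + 1))"
    have \<theta>: "0 < \<theta>"
      using \<epsilon> by (simp add: \<theta>_def add_nonneg_pos)
    have \<theta>_le: "real k * (norm b * \<theta>) \<le> \<epsilon> / 2"
    proof -
      have "real k * (norm b * \<theta>) \<le> (real k + 1) * ((norm b + 1) * \<theta>)"
        using \<theta> by (intro mult_mono) auto
      also have "\<dots> = \<epsilon> / 2"
        using norm_ge_zero[of b] by (simp add: \<theta>_def add_nonneg_eq_0_iff field_simps)
      finally show ?thesis .
    qed
    obtain M where M: "\<And>i j. \<lbrakk>M \<le> i; M \<le> j\<rbrakk> \<Longrightarrow> cmod (entry e x i j) \<le> \<theta>"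
      by (rule IH_entryE[OF x \<theta>]) (rule that)
    \<comment> \<open>Beyond \<open>N\<close>, rows and columns of \<open>b\<close> vanish at
      positions below \<open>M\<close>, so every surviving summation index \<open>m\<close> is at
      least \<open>M\<close>, where \<open>x\<close> is small.\<close>
    obtain N where N: "\<And>m n. \<lbrakk>m < M; N \<le> n\<rbrakk> \<Longrightarrow> entry e b m n = 0"
      "\<And>m n. \<lbrakk>m < M; N \<le> n\<rbrakk> \<Longrightarrow> entry e b n m = 0"
      by (rule Binf_entries_far_zeroE[OF b(1)]) (rule that)
    have sum_le: "cmod z \<le> \<epsilon> / 2"
      if "finite F" "card F \<le> k" "t sums z" "\<And>m. m \<notin> F \<Longrightarrow> t m = 0"
        "\<And>m. m \<in> F \<Longrightarrow> cmod (t m) \<le> norm b * \<theta>" for F t z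
    proof -
      have "z = (\<Sum>m\<in>F. t m)"
        by (rule sums_unique2[OF that(3) sums_finite[OF that(1,4)]])
      then have "cmod z \<le> real (card F) * (norm b * \<theta>)"
        using that by (simp add: sum_norm_bound)
      also have "\<dots> \<le> real k * (norm b * \<theta>)"
        using that \<theta> by (intro mult_right_mono) auto
      finally show ?thesis
        using \<theta>_le by simp
    qed
    have "cmod (entry e (a o\<^sub>L x) i j) \<le> \<epsilon> \<and> cmod (entry e (x o\<^sub>L a) i j) \<le> \<epsilon>"
      if ij: "max M N \<le> i" "max M N \<le> j" for i j
    proof
      have "cmod (entry e (b o\<^sub>L x) i j) \<le> \<epsilon> / 2"
      proof (rule sum_le[OF k(1,2)[of i]])
        show "(\<lambda>m. entry e b i m * entry e x m j) sums entry e (b o\<^sub>L x) i j"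
          using b Binf_subset by (intro entry_compose) auto
        fix m
        assume "m \<in> {m. entry e b i m \<noteq> 0}"
        then have "M \<le> m"
          using N(2)[of m i] ij by force
        then show "cmod (entry e b i m * entry e x m j) \<le> norm b * \<theta>"
          using M[of m j] ij cmod_entry_le[of b i m] by (auto simp: norm_mult intro: mult_mono)
      qed simp
      moreover have "norm ((a - b) o\<^sub>L x) \<le> \<epsilon> / 2"
        using norm_blinfun_compose[of "a - b" x] b(2) \<eta>(2)
          mult_right_mono[of "norm (a - b)" \<eta> "norm x"] by simp
      moreover have "a o\<^sub>L x = (b o\<^sub>L x) + ((a - b) o\<^sub>L x)"
        by (rule blinfun_eqI) (simp add: blinfun.bilinear_simps)
      ultimately show "cmod (entry e (a o\<^sub>L x) i j) \<le> \<epsilon>"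
        using cmod_entry_le[of "(a - b) o\<^sub>L x" i j]
          norm_triangle_ineq[of "entry e (b o\<^sub>L x) i j" "entry e ((a - b) o\<^sub>L x) i j"]
        by (simp add: entry_add)
      have "cmod (entry e (x o\<^sub>L b) i j) \<le> \<epsilon> / 2"
      proof (rule sum_le[OF k(3,4)[of j]])
        show "(\<lambda>m. entry e x i m * entry e b m j) sums entry e (x o\<^sub>L b) i j"
          using xops by (rule entry_compose)
        fix m
        assume "m \<in> {m. entry e b m j \<noteq> 0}"
        then have "M \<le> m"
          using N(1)[of m j] ij by force
        then show "cmod (entry e x i m * entry e b m j) \<le> norm b * \<theta>"
          using M[of i m] ij cmod_entry_le[of b m j] \<theta>
          by (subst mult.commute) (auto simp: norm_mult intro: mult_mono)
      qed simp
      moreover have "norm (x o\<^sub>L (a - b)) \<le> \<epsilon> / 2"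
        using norm_blinfun_compose[of x "a - b"] b(2) \<eta>(2)
          mult_right_mono[of "norm (a - b)" \<eta> "norm x"] by (simp add: mult.commute)
      moreover have "x o\<^sub>L a = (x o\<^sub>L b) + (x o\<^sub>L (a - b))"
        by (rule blinfun_eqI) (simp add: blinfun.bilinear_simps)
      ultimately show "cmod (entry e (x o\<^sub>L a) i j) \<le> \<epsilon>"
        using cmod_entry_le[of "x o\<^sub>L (a - b)" i j]
          norm_triangle_ineq[of "entry e (x o\<^sub>L b) i j" "entry e (x o\<^sub>L (a - b)) i j"]
        by (simp add: entry_add)
    qed
    then show ?thesis
      by blast
  qed
  have "\<exists>N. \<forall>i\<ge>N. \<forall>j\<ge>N. cmod (entry e (a o\<^sub>L x) i j) \<le> \<epsilon>"
    "\<exists>N. \<forall>i\<ge>N. \<forall>j\<ge>N. cmod (entry e (x o\<^sub>L a) i j) \<le> \<epsilon>" if "0 < \<epsilon>" for \<epsilon>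
    using main[OF that] by blast+
  then show "a o\<^sub>L x \<in> IH e" "x o\<^sub>L a \<in> IH e"
    unfolding IH_iff using Bf_compose[OF a xBf] Bf_compose[OF xBf a] by simp_all
qed

text \<open>Scaling is composition with a multiple of the identity, which lies in
  \<open>Bf e\<close>.\<close>

lemma IH_scaleC_op:
  assumes "a \<in> IH e"
  shows "scaleC_op c a \<in> IH e"
proof -
  have "scaleC_op c a = scaleC_op c id_blinfun o\<^sub>L a"
    by (rule blinfun_eqI) (simp add: scaleC_op_apply)
  then show ?thesis
    using IH_compose_left[OF Bf_scaleC_op[OF id_in_Bf] assms] by simp
qed

lemma zero_in_IH: "0 \<in> IH e"
proof -
  have "(0 :: 'a \<Rightarrow>\<^sub>L 'a) \<in> Bf e"
    using Bf_diff[OF id_in_Bf id_in_Bf] by simp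
  then show ?thesis
    by (auto simp: IH_iff entry_zero)
qed

text \<open>Properness comes from the identity, whose diagonal entries stay equal to 1.\<close>

lemma proper_closed_ideal_IH: "proper_closed_ideal (Bf e) (IH e)"
proof -
  have "id_blinfun \<notin> IH e"
  proof
    assume "id_blinfun \<in> IH e"
    then obtain N where "\<And>i j. \<lbrakk>N \<le> i; N \<le> j\<rbrakk> \<Longrightarrow> cmod (entry e id_blinfun i j) \<le> 1 / 2"
      using IH_entryE[of id_blinfun "1 / 2"] by auto
    from this[of N N] show False
      by (simp add: entry_id)
  qed
  then have "IH e \<noteq> Bf e"
    using id_in_Bf by blast
  moreover have "IH e \<subseteq> Bf e"
    by (auto simp: IH_iff)
  ultimately show ?thesis
    unfolding proper_closed_ideal_def two_sided_ideal_def
    by (simp add: zero_in_IH IH_add IH_scaleC_op IH_compose closed_IH)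
qed

section \<open>Maximality: compression to an almost diagonal matrix\<close>

lemma weighted_shift_in_Binf:
  assumes T: "T \<in> bounded_ops"
      "\<And>x. (\<lambda>k. (w k * cinner x (e (g k))) *\<^sub>C e (f k)) sums blinfun_apply T x"
    and f: "inj f" and g: "inj g"
  shows "T \<in> Binf e"
proof -
  \<comment> \<open>Nonzero entries sit only at positions \<open>(f k, g k)\<close>; injectivity
    then allows at most one per row and per column.\<close>
  have nz: "\<exists>k. j = g k \<and> i = f k" if "entry e T i j \<noteq> 0" for i j
  proof (rule ccontr)
    assume "\<not> ?thesis"
    then have "(\<lambda>k. cinner ((w k * cinner (e j) (e (g k))) *\<^sub>C e (f k)) (e i)) = (\<lambda>_. 0)"
      by (intro ext) (auto simp: cinner_scaleC_left cinner_basis)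
    then have "(\<lambda>_. 0) sums entry e T i j"
      using bounded_linear.sums[OF bounded_linear_cinner_basis[of i] T(2)[of "e j"]]
      by (simp add: entry_def)
    then show False
      using that sums_unique2[OF sums_zero] by metis
  qed
  show ?thesis
  proof (rule BinfI[OF T(1), where k = 1])
    show "\<exists>F. finite F \<and> card F \<le> 1 \<and> {j. entry e T i j \<noteq> 0} \<subseteq> F" for i
      \<comment> \<open>If \<open>i\<close> is outside the range of \<open>f\<close>, then
        \<open>inv f i\<close> is arbitrary, but row \<open>i\<close> is zero and any singleton
        covers its support.\<close>
      using f by (intro exI[of _ "{g (inv f i)}"]) (auto dest: nz)
    show "\<exists>F. finite F \<and> card F \<le> 1 \<and> {i. entry e T i j \<noteq> 0} \<subseteq> F" for j
      using g by (intro exI[of _ "{f (inv g j)}"]) (auto dest: nz)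
  qed
qed

text \<open>Here \<open>d\<close> is \<open>b a c\<close>, where \<open>c\<close> sends
  \<open>e l\<close> to \<open>e (j l)\<close>, selecting columns, and \<open>b\<close> reads
  coordinate \<open>i k\<close> into position \<open>k\<close> with weight \<open>w k\<close>,
  selecting and scaling rows. Both factors are weighted shifts, hence in
  \<open>Bf e\<close>.\<close>

lemma compress_in_ideal:
  assumes J: "two_sided_ideal (Bf e) J" and a: "a \<in> J"
    and ij: "inj i" "inj j" and W: "\<And>k. cmod (w k) \<le> W"
  obtains d where "d \<in> J" "\<And>k l. entry e d k l = w k * entry e a (i k) (j l)"
proof -
  obtain b where b: "b \<in> bounded_ops"
    "\<And>x. (\<lambda>k. (w k * cinner x (e (i k))) *\<^sub>C e (id k)) sums blinfun_apply b x"
    by (rule exists_weighted_shift[where w = w, OF inj_on_id ij(1) W]) (rule that)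
  obtain c where c: "c \<in> bounded_ops"
    "\<And>x. (\<lambda>k. (1 * cinner x (e (id k))) *\<^sub>C e (j k)) sums blinfun_apply c x"
    by (rule exists_weighted_shift[where w = "\<lambda>_. 1" and W = 1, OF ij(2) inj_on_id])
      (simp, rule that)
  have bc: "b \<in> Bf e" "c \<in> Bf e"
    using weighted_shift_in_Binf[OF b inj_on_id ij(1)] weighted_shift_in_Binf[OF c ij(2) inj_on_id]
      Binf_subset_Bf by auto
  have ce: "blinfun_apply c (e l) = e (j l)" for l
  proof -
    have "(\<lambda>k. (1 * cinner (e l) (e (id k))) *\<^sub>C e (j k)) = (\<lambda>k. if k = l then e (j k) else 0)"
      by (auto simp: cinner_basis scaleC_one)
    then show ?thesis
      using c(2)[of "e l"] sums_single[of l "\<lambda>k. e (j k)"] sums_unique2 by metis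
  qed
  have be: "cinner (blinfun_apply b x) (e k) = w k * cinner x (e (i k))" for x k
  proof -
    have "(\<lambda>m. cinner ((w m * cinner x (e (i m))) *\<^sub>C e (id m)) (e k))
        = (\<lambda>m. if m = k then w m * cinner x (e (i m)) else 0)"
      by (auto simp: cinner_basis cinner_scaleC_left)
    then show ?thesis
      using bounded_linear.sums[OF bounded_linear_cinner_basis[of k] b(2)[of x]]
        sums_single[of k "\<lambda>m. w m * cinner x (e (i m))"] sums_unique2 by metis
  qed
  show ?thesis
  proof (rule that)
    show "b o\<^sub>L (a o\<^sub>L c) \<in> J"
      by (intro two_sided_idealD(5,6)[OF J] bc a)
    show "entry e (b o\<^sub>L (a o\<^sub>L c)) k l = w k * entry e a (i k) (j l)" for k l
      by (simp add: entry_def ce be)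
  qed
qed

text \<open>Pairs are chosen one after another. Since rows and columns of \<open>a\<close> tend to
  zero, the next pair can be taken so far out that the new column is small in all earlier rows and
  the new row in all earlier columns.\<close>

lemma exists_almost_diagonal_subsequence:
  assumes a: "a \<in> Bf e" and big: "\<And>N. \<exists>i\<ge>N. \<exists>j\<ge>N. \<delta> < cmod (entry e a i j)"
    and \<epsilon>: "\<And>n. 0 < \<epsilon> n"
  obtains i j :: "nat \<Rightarrow> nat" where "strict_mono i" "strict_mono j"
    "\<And>k. \<delta> < cmod (entry e a (i k) (j k))"
    "\<And>k l. k \<noteq> l \<Longrightarrow> cmod (entry e a (i k) (j l)) < \<epsilon> (max k l)"
proof -
  define P where "P p \<longleftrightarrow> \<delta> < cmod (entry e a (fst p) (snd p))" for p
  \<comment> \<open>Dependent choice relates consecutive pairs only. Ranging over all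
    \<open>m\<close> up to the maximum of \<open>p\<close> covers every earlier index as well;
    \<open>q\<close> is pair number \<open>Suc n\<close>, hence the tolerance
    \<open>\<epsilon> (Suc n)\<close>.\<close>
  define Q where "Q n p q \<longleftrightarrow> (\<forall>m \<le> max (fst p) (snd p). m < fst q \<and> m < snd q \<and>
      cmod (entry e a m (snd q)) < \<epsilon> (Suc n) \<and> cmod (entry e a (fst q) m) < \<epsilon> (Suc n))"
    for n and p q :: "nat \<times> nat"
  have "\<exists>p. P p"
    using big[of 0] by (auto simp: P_def)
  moreover have "\<exists>q. P q \<and> Q n p q" for n p
  proof -
    obtain N where N:
      "\<And>m m'. \<lbrakk>m < Suc (max (fst p) (snd p)); N \<le> m'\<rbrakk> \<Longrightarrow> cmod (entry e a m m') < \<epsilon> (Suc n)"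
      "\<And>m m'. \<lbrakk>m < Suc (max (fst p) (snd p)); N \<le> m'\<rbrakk> \<Longrightarrow> cmod (entry e a m' m) < \<epsilon> (Suc n)"
      using Bf_entries_far_small[OF a \<epsilon>] by blast
    obtain i j where "max N (Suc (max (fst p) (snd p))) \<le> i" "max N (Suc (max (fst p) (snd p))) \<le> j"
      "\<delta> < cmod (entry e a i j)"
      using big by blast
    then have "P (i, j) \<and> Q n p (i, j)"
      using N by (auto simp: P_def Q_def)
    then show ?thesis
      by blast
  qed
  ultimately obtain s where s: "\<And>n. P (s n)" "\<And>n. Q n (s n) (s (Suc n))"
    using dependent_nat_choice[of "\<lambda>_. P" Q] by metis
  define t where "t n = max (fst (s n)) (snd (s n))" for n
  have step: "m < fst (s (Suc n))" "m < snd (s (Suc n))"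
    "cmod (entry e a m (snd (s (Suc n)))) < \<epsilon> (Suc n)"
    "cmod (entry e a (fst (s (Suc n))) m) < \<epsilon> (Suc n)" if "m \<le> t n" for m n
    using s(2)[of n] that by (auto simp: Q_def t_def)
  have "strict_mono t"
    unfolding strict_mono_Suc_iff using step(1)[OF order_refl] by (auto simp: t_def less_max_iff_disj)
  then have t_mono: "t k \<le> t n" if "k \<le> n" for k n
    using that by (simp add: strict_mono_less_eq)
  show ?thesis
  proof (rule that[of "fst \<circ> s" "snd \<circ> s"])
    show "strict_mono (fst \<circ> s)" "strict_mono (snd \<circ> s)"
      unfolding strict_mono_Suc_iff by (auto intro: step simp: t_def)
    show "\<delta> < cmod (entry e a ((fst \<circ> s) k) ((snd \<circ> s) k))" for k
      using s(1) by (simp add: P_def)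
    fix k l :: nat
    assume "k \<noteq> l"
    \<comment> \<open>The later of the two indices is a successor, so the conditions imposed at
      stage \<open>n\<close> apply to it.\<close>
    then consider n where "l = Suc n" "k \<le> n" | n where "k = Suc n" "l \<le> n"
      by (metis less_Suc_eq_le linorder_neqE_nat Nat.lessE less_imp_Suc_add)
    then show "cmod (entry e a ((fst \<circ> s) k) ((snd \<circ> s) l)) < \<epsilon> (max k l)"
    proof cases
      case 1
      then have "fst (s k) \<le> t n"
        using t_mono[of k n] by (simp add: t_def)
      then show ?thesis
        using step(3) 1 by (simp add: max_def)
    next
      case 2
      then have "snd (s l) \<le> t n"
        using t_mono[of l n] by (simp add: t_def)
      then show ?thesis
        using step(4) 2 by (simp add: max_def)
    qed
  qed
qed

text \<open>Scaling the compressed matrix to have diagonal 1 gives an element of \<open>J\<close>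
  within distance 1/2 of the identity, to which the Neumann series argument applies.\<close>

lemma id_in_ideal:
  assumes J: "two_sided_ideal (Bf e) J" "closed J" and a: "a \<in> J" "a \<notin> IH e"
  shows "id_blinfun \<in> J"
proof -
  have aBf: "a \<in> Bf e"
    using two_sided_idealD(1)[OF J(1)] a by blast
  then obtain \<delta> where \<delta>: "0 < \<delta>" "\<And>N. \<exists>i\<ge>N. \<exists>j\<ge>N. \<delta> < cmod (entry e a i j)"
    using a(2) unfolding IH_iff not_le[symmetric] by blast
  \<comment> \<open>Division by diagonal entries larger than \<delta> turns this tolerance into 1/8
    times \<open>(1/4) ^ max k l\<close>. As \<open>k + l\<close> is at most
    \<open>2 * max k l\<close>, it is dominated by 1/8 times \<open>(1/2) ^ k * (1/2) ^ l\<close>,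
    with total sum 1/2.\<close>
  obtain i j where ij: "strict_mono i" "strict_mono j"
    "\<And>k. \<delta> < cmod (entry e a (i k) (j k))"
    "\<And>k l. k \<noteq> l \<Longrightarrow> cmod (entry e a (i k) (j l)) < \<delta> / 8 * (1 / 4) ^ max k l"
    using exists_almost_diagonal_subsequence[OF aBf \<delta>(2), of "\<lambda>n. \<delta> / 8 * (1 / 4) ^ n"] \<delta>(1)
    by auto
  define w where "w k = inverse (entry e a (i k) (j k))" for k
  have w: "cmod (w k) \<le> inverse \<delta>" for k
    using ij(3)[of k] \<delta>(1) unfolding w_def norm_inverse by (intro le_imp_inverse_le) auto
  obtain d where d: "d \<in> J" "\<And>k l. entry e d k l = w k * entry e a (i k) (j l)"
    by (rule compress_in_ideal[where w = w, OF J(1) a(1) strict_mono_imp_inj_on[OF ij(1)]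
          strict_mono_imp_inj_on[OF ij(2)] w]) (rule that)
  have rBf: "id_blinfun - d \<in> Bf e"
    using Bf_diff[OF id_in_Bf] d(1) two_sided_idealD(1)[OF J(1)] by blast
  have "cmod (entry e (id_blinfun - d) k l) \<le> (1 / 8 * (1 / 2) ^ k) * (1 / 2) ^ l" for k l
  proof (cases "k = l")
    case True
    have "entry e a (i k) (j k) \<noteq> 0"
      using ij(3)[of k] \<delta>(1) by auto
    then show ?thesis
      using True by (simp add: entry_diff entry_id d(2) w_def)
  next
    case False
    have "cmod (entry e (id_blinfun - d) k l) = cmod (w k) * cmod (entry e a (i k) (j l))"
      using False by (simp add: entry_diff entry_id d(2) norm_mult)
    also have "\<dots> \<le> inverse \<delta> * (\<delta> / 8 * (1 / 4) ^ max k l)"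
      using w[of k] ij(4)[OF False] \<delta>(1) by (intro mult_mono) auto
    also have "\<dots> = 1 / 8 * (1 / 2) ^ (2 * max k l)"
      using \<delta>(1) by (simp add: power_mult power2_eq_square)
    also have "\<dots> \<le> 1 / 8 * (1 / 2) ^ (k + l)"
      by (intro mult_left_mono power_decreasing) auto
    finally show ?thesis
      by (simp add: power_add)
  qed
  moreover have geo: "(\<lambda>k. (1 / 2) ^ k) sums (2 :: real)"
    using geometric_sums[of "1 / 2 :: real"] by simp
  ultimately have "norm (id_blinfun - d) \<le> (1 / 8 * 2) * 2"
    using rBf Bf_subset by (intro norm_le_sum_entries[OF _ _ sums_mult[OF geo] geo]) auto
  then show ?thesis
    using closed_ideal_contains_id[OF J d(1) rBf] by simp
qed

text \<open>Otherwise \<open>J\<close> contains the identity, and then absorbs all of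
  \<open>Bf e\<close>.\<close>

lemma proper_closed_ideal_subset_IH:
  assumes "proper_closed_ideal (Bf e) J"
  shows "J \<subseteq> IH e"
proof (rule ccontr)
  assume "\<not> J \<subseteq> IH e"
  then have id: "id_blinfun \<in> J"
    using assms id_in_ideal by (auto simp: proper_closed_ideal_def)
  have J: "two_sided_ideal (Bf e) J" "J \<noteq> Bf e"
    using assms by (auto simp: proper_closed_ideal_def)
  have "x \<in> J" if "x \<in> Bf e" for x
  proof -
    have "x o\<^sub>L id_blinfun = x"
      by (rule blinfun_eqI) simp
    then show ?thesis
      using two_sided_idealD(5)[OF J(1) that id] by simp
  qed
  then show False
    using J two_sided_idealD(1) by blast
qed

end

theorem theorem3p1:
  fixes e :: "nat \<Rightarrow> 'a::chilbert_space"
  assumes "orthonormal_basis e"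
  shows "proper_closed_ideal (Bf e) (IH e) \<and>
         (\<forall>J. proper_closed_ideal (Bf e) J \<longrightarrow> J \<subseteq> IH e)"
proof -
  interpret hilbert_basis e
    using assms by unfold_locales
  show ?thesis
    using proper_closed_ideal_IH proper_closed_ideal_subset_IH by blast
qed

end
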